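(* Let $\{X_n\}_{n\ge 0}$ be the homogeneous discrete-time Markov chain on $\{0,1,2,\dots\}$ with $X_0=0$ and transition probabilities $$P(X_{n+1}=i+1\mid X_n=i)=\frac{1}{1+i},\qquad P(X_{n+1}=i\mid X_n=i)=\frac{i}{1+i},$$ and let $p_{n,k}=P(X_n=k)$; equivalently, $(p_{n,k})_{n,k\ge0}$ is the array determined by $$\begin{cases} p_{n+1,k}=\dfrac{k}{k+1}\,p_{n,k}+\dfrac1k\,p_{n,k-1}, & n\ge 0,\ 1\le k\le n+1,\\ p_{i,j}=0, & i\ge 0,\ j\ge i+1,\\ p_{0,0}=1,\quad p_{n,0}=0, & n\ge 1.\end{cases}$$ Then for all integers $n\ge k\ge 1$, $$p_{n,k}=\frac{1}{k!}\sum_{i=1}^{k}(-1)^{k-i}\binom{k+1}{i+1}\,i^{k}\left(\frac{i}{i+1}\right)^{n-k}.$$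
   Context: The chain $\{X_n\}$ is the subordinated chain of the pure birth process with intensities $\lambda_k=\frac1{1+k}$. All transition probabilities not listed are zero. *)

theory Defs
  imports "HOL-Probability.Probability"
begin

text \<open>
  Conditional probabilities are constrained only on conditioning events of positive
  probability, since \<^const>\<open>cond_prob\<close> divides by zero on null events.
\<close>

definition homogeneous_markov_chain ::
  "'a measure \<Rightarrow> (nat \<Rightarrow> 'a \<Rightarrow> nat) \<Rightarrow> (nat \<Rightarrow> nat \<Rightarrow> real) \<Rightarrow> bool" where
  "homogeneous_markov_chain M X K \<longleftrightarrow>
     prob_space M \<and>
     (\<forall>n. X n \<in> measurable M (count_space UNIV)) \<and>
     (\<forall>n h j. \<P>(\<omega> in M. \<forall>m\<le>n. X m \<omega> = h m) > 0 \<longrightarrow>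
        \<P>(\<omega> in M. X (Suc n) \<omega> = j \<bar> \<forall>m\<le>n. X m \<omega> = h m) =
        \<P>(\<omega> in M. X (Suc n) \<omega> = j \<bar> X n \<omega> = h n)) \<and>
     (\<forall>n i j. \<P>(\<omega> in M. X n \<omega> = i) > 0 \<longrightarrow>
        \<P>(\<omega> in M. X (Suc n) \<omega> = j \<bar> X n \<omega> = i) = K i j)"

definition birth_kernel :: "nat \<Rightarrow> nat \<Rightarrow> real" where
  "birth_kernel i j =
     (if j = i + 1 then 1 / (1 + real i)
      else if j = i then real i / (1 + real i)
      else 0)"

definition subordinated_birth_chain :: "'a measure \<Rightarrow> (nat \<Rightarrow> 'a \<Rightarrow> nat) \<Rightarrow> bool" where
  "subordinated_birth_chain M X \<longleftrightarrow>
     homogeneous_markov_chain M X birth_kernel \<and> (AE \<omega> in M. X 0 \<omega> = 0)"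

definition birth_array :: "(nat \<Rightarrow> nat \<Rightarrow> real) \<Rightarrow> bool" where
  "birth_array p \<longleftrightarrow>
     (\<forall>n k. 1 \<le> k \<and> k \<le> n + 1 \<longrightarrow>
        p (n + 1) k = real k / (real k + 1) * p n k + 1 / real k * p n (k - 1)) \<and>
     (\<forall>i j. i + 1 \<le> j \<longrightarrow> p i j = 0) \<and>
     p 0 0 = 1 \<and>
     (\<forall>n\<ge>1. p n 0 = 0)"

end

theory Submission
  imports Defs
begin

text \<open>
  The recursion on row \<open>n\<close> and the boundary values determine the next row, so a solution array is
  unique; it remains to see that the claimed formula, extended by the boundary values, is a solution
  (\<open>birth_array_explicit_array\<close>) and that the law of the chain is one
  (\<open>birth_array_of_chain\<close>).

  In column \<open>k\<close> the formula is a combination of the geometric sequences with ratios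
  \<open>r i = i / (i + 1)\<close> for \<open>i = 1, ..., k\<close>, which are the holding probabilities of the states up to
  \<open>k\<close>. Substituting it into the recursion and comparing the coefficients of each geometric sequence
  leaves, for the coefficient \<open>c k i\<close> of \<open>r i ^ (n - k)\<close> in column \<open>k\<close>, the identity
  \<open>(r i - r k) * c k i = r i / k * c (k - 1) i\<close>, which comes from the absorption rule for binomial
  coefficients (\<open>geometric_mixture_recurrence\<close>). The diagonal entry of row \<open>n + 1 = k\<close> is included
  by allowing negative exponents: the recursion then refers to the formula at \<open>n = k - 1\<close>, where the array is required to vanish. For
  \<open>k \<ge> 2\<close> the sum there is a multiple of the \<open>k\<close>-th finite difference of a monomial of degree
  \<open>k - 1\<close>, so it is zero (\<open>alternating_binomial_power_sum\<close>, \<open>geometric_mixture_above_diagonal\<close>).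
\<close>

section \<open>Finite differences of monomials\<close>

text \<open>
  Up to sign this is the \<open>n\<close>-th finite difference at 0 of \<open>x ^ j\<close>. Absorbing one factor \<open>i\<close> into
  the binomial coefficient lowers \<open>n\<close> by one and replaces \<open>i ^ j\<close> by \<open>(i + 1) ^ (j - 1)\<close>, which is
  a combination of powers \<open>i ^ q\<close> with \<open>q\<close> below the new \<open>n\<close>.
\<close>
lemma alternating_binomial_power_sum:
  "j < n \<Longrightarrow> (\<Sum>i\<le>n. (-1) ^ i * of_nat (n choose i) * of_nat i ^ j) = (0 :: 'a::comm_ring_1)"
proof (induction n arbitrary: j)
  case 0
  then show ?case by simp
next
  case (Suc m)
  show ?case
  proof (cases j)
    case 0
    then show ?thesis
      using choose_alternating_sum[of "Suc m", where 'a = 'a] by simp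
  next
    case (Suc l)
    with Suc.prems have "l < m" by simp
    have absorb: "of_nat (Suc m choose Suc i) * of_nat (Suc i) = (of_nat (Suc m) * of_nat (m choose i) :: 'a)"
      for i
      by (metis Suc_times_binomial_eq mult.commute of_nat_mult)
    have expand: "of_nat (Suc i) ^ l = (\<Sum>q\<le>l. of_nat (l choose q) * of_nat i ^ q :: 'a)" for i
      using binomial_ring[of "of_nat i" "1::'a" l] by (simp add: add.commute)
    have "(\<Sum>i\<le>Suc m. (-1) ^ i * of_nat (Suc m choose i) * of_nat i ^ j :: 'a)
        = (\<Sum>i\<le>m. (-1) ^ Suc i * (of_nat (Suc m choose Suc i) * of_nat (Suc i)) * of_nat (Suc i) ^ l)"
      by (subst sum.atMost_Suc_shift) (simp add: \<open>j = Suc l\<close> mult.assoc del: of_nat_Suc binomial_Suc_Suc)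
    also have "\<dots> = (\<Sum>i\<le>m. \<Sum>q\<le>l. - of_nat (Suc m) * of_nat (l choose q)
                       * ((-1) ^ i * of_nat (m choose i) * of_nat i ^ q))"
      unfolding absorb
      by (intro sum.cong refl) (simp only: expand, simp add: sum_distrib_left mult_ac sum_negf del: of_nat_Suc)
    also have "\<dots> = (\<Sum>q\<le>l. - of_nat (Suc m) * of_nat (l choose q)
                       * (\<Sum>i\<le>m. (-1) ^ i * of_nat (m choose i) * of_nat i ^ q))"
      by (subst sum.swap) (simp add: sum_distrib_left)
    also have "\<dots> = 0"
      using Suc.IH \<open>l < m\<close> by (intro sum.neutral) auto
    finally show ?thesis .
  qed
qed

section \<open>The closed form as a mixture of geometric sequences\<close>

text \<open>
  The exponent is an integer because the recurrence at a diagonal entry refers to \<open>n = k - 1\<close>, where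
  the exponent is \<open>-1\<close>.
\<close>
definition geometric_mixture :: "nat \<Rightarrow> nat \<Rightarrow> real" where
  "geometric_mixture n k = 1 / fact k *
     (\<Sum>i=1..k. (-1) ^ (k - i) * real ((k + 1) choose (i + 1)) * real i ^ k *
        (real i / (real i + 1)) powi (int n - int k))"

lemma geometric_mixture_below_diagonal:
  assumes "k \<le> n"
  shows "geometric_mixture n k = 1 / fact k *
     (\<Sum>i=1..k. (-1) ^ (k - i) * real ((k + 1) choose (i + 1)) * real i ^ k *
        (real i / (real i + 1)) ^ (n - k))"
  using assms unfolding geometric_mixture_def
  by (simp add: of_nat_diff[symmetric] del: of_nat_diff)

text \<open>
  The difference of the ratios \<open>i / (i + 1)\<close> and \<open>k / (k + 1)\<close> is \<open>(i - k) / ((i + 1) * (k + 1))\<close>;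
  its factor \<open>(k - i) / (k + 1)\<close> turns \<open>k + 1\<close> choose \<open>i + 1\<close> into \<open>k\<close> choose \<open>i + 1\<close>. The other
  factor \<open>1 / (i + 1)\<close>, with one of the \<open>k\<close> factors \<open>i\<close> of the coefficient, is the further power of
  the ratio that column \<open>k - 1\<close> carries.
\<close>
lemma geometric_mixture_recurrence:
  "geometric_mixture (Suc n) (Suc m)
     = real (Suc m) / (real (Suc m) + 1) * geometric_mixture n (Suc m)
       + 1 / real (Suc m) * geometric_mixture n m"
proof -
  define z where "z i = (real i / (real i + 1)) powi (int n - int (Suc m))" for i
  define c where "c i = (-1) ^ (Suc m - i) * real ((Suc m + 1) choose (i + 1)) * real i ^ Suc m" for i
  define d where "d i = (-1) ^ (m - i) * real ((m + 1) choose (i + 1)) * real i ^ m" for i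
  have shift: "(real i / (real i + 1)) powi (int n - int m) = real i / (real i + 1) * z i"
    if "i \<ge> 1" for i
  proof -
    have "int n - int m = (int n - int (Suc m)) + 1" by simp
    then show ?thesis
      unfolding z_def using that by (metis (no_types, lifting) power_int_add_1' divide_eq_0_iff
        of_nat_0_eq_iff of_nat_Suc add.commute nat.distinct(1) not_one_le_zero)
  qed
  have coeff: "c i * (real i / (real i + 1))
      = real (Suc m) / (real (Suc m) + 1) * c i + d i * (real i / (real i + 1))"
    if "i \<in> {1..Suc m}" for i
  proof (cases "i = Suc m")
    case True
    then show ?thesis by (simp add: c_def d_def binomial_eq_0 del: binomial_Suc_Suc)
  next
    case False
    with that have i: "i \<le> m" by simp
    define e :: real where "e = (-1) ^ (m - i) * real i ^ m"
    have sign: "c i = - e * real i * real (Suc (Suc m) choose Suc i)"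
      using i by (simp add: c_def e_def Suc_diff_le del: binomial_Suc_Suc)
    have d: "d i = e * real (Suc m choose Suc i)"
      by (simp add: d_def e_def del: binomial_Suc_Suc)
    have "(Suc (Suc m) - Suc i) * (Suc (Suc m) choose Suc i) = Suc (Suc m) * (Suc m choose Suc i)"
      using binomial_absorb_comp[of "Suc (Suc m)" "Suc i"] by simp
    then have "real ((Suc (Suc m) - Suc i) * (Suc (Suc m) choose Suc i))
        = real (Suc (Suc m) * (Suc m choose Suc i))"
      by (rule arg_cong)
    then have "(real m + 1 - real i) * real (Suc (Suc m) choose Suc i)
        = (real m + 2) * real (Suc m choose Suc i)"
      unfolding of_nat_mult using i by (simp add: of_nat_diff add_ac del: binomial_Suc_Suc)
    then have choose: "real (Suc m choose Suc i)
        = (real m + 1 - real i) * real (Suc (Suc m) choose Suc i) / (real m + 2)"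
      by (simp add: field_simps del: binomial_Suc_Suc)
    have "real m + 2 \<noteq> 0" "real i + 1 \<noteq> 0" by linarith+
    then show ?thesis
      unfolding sign d choose by (simp add: divide_simps del: binomial_Suc_Suc) (simp add: algebra_simps del: binomial_Suc_Suc)
  qed
  have "(\<Sum>i=1..Suc m. c i * (real i / (real i + 1)) * z i)
      = (\<Sum>i=1..Suc m. (real (Suc m) / (real (Suc m) + 1) * c i + d i * (real i / (real i + 1))) * z i)"
    by (intro sum.cong refl) (simp only: coeff)
  also have "\<dots> = real (Suc m) / (real (Suc m) + 1) * (\<Sum>i=1..Suc m. c i * z i)
      + (\<Sum>i=1..Suc m. d i * (real i / (real i + 1)) * z i)"
    by (simp only: distrib_right sum.distrib sum_distrib_left mult.assoc)
  \<comment> \<open>The coefficient \<open>d (Suc m)\<close> contains \<open>m + 1\<close> choose \<open>m + 2\<close>, so that column \<open>m\<close> may be summed up to \<open>m + 1\<close>.\<close>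
  also have "(\<Sum>i=1..Suc m. d i * (real i / (real i + 1)) * z i)
      = (\<Sum>i=1..m. d i * (real i / (real i + 1)) * z i)"
    by (simp add: d_def binomial_eq_0)
  finally have sums: "(\<Sum>i=1..Suc m. c i * (real i / (real i + 1)) * z i)
      = real (Suc m) / (real (Suc m) + 1) * (\<Sum>i=1..Suc m. c i * z i)
        + (\<Sum>i=1..m. d i * (real i / (real i + 1)) * z i)" .
  have "geometric_mixture (Suc n) (Suc m)
      = 1 / fact (Suc m) * (\<Sum>i=1..Suc m. c i * (real i / (real i + 1)) * z i)"
    unfolding geometric_mixture_def
    by (rule arg_cong2[where f = "(*)", OF refl sum.cong[OF refl]])
       (simp add: c_def shift mult.assoc del: binomial_Suc_Suc)
  moreover have "geometric_mixture n (Suc m) = 1 / fact (Suc m) * (\<Sum>i=1..Suc m. c i * z i)"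
    unfolding geometric_mixture_def by (simp only: c_def z_def)
  moreover have "geometric_mixture n m = 1 / fact m * (\<Sum>i=1..m. d i * (real i / (real i + 1)) * z i)"
    unfolding geometric_mixture_def
    by (rule arg_cong2[where f = "(*)", OF refl sum.cong[OF refl]])
       (simp add: d_def shift mult.assoc del: binomial_Suc_Suc)
  moreover have "1 / fact (Suc m) = 1 / real (Suc m) * (1 / fact m :: real)"
    by simp
  ultimately show ?thesis
    by (simp only: sums distrib_left) (simp only: mult_ac)
qed

text \<open>
  The power of the ratio is \<open>(i + 1) / i\<close> here, and its numerator is absorbed by the binomial
  coefficient; what remains is the finite difference of order \<open>m + 1\<close> of \<open>x ^ m\<close>. For \<open>m = 0\<close> the
  summand at \<open>i = 0\<close> does not vanish and the value is 2.
\<close>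
lemma geometric_mixture_above_diagonal:
  assumes "m \<ge> 1"
  shows "geometric_mixture m (Suc m) = 0"
proof -
  have summand: "(-1) ^ (Suc m - i) * real ((Suc m + 1) choose (i + 1)) * real i ^ Suc m *
        (real i / (real i + 1)) powi (int m - int (Suc m))
      = (-1) ^ Suc m * real (Suc (Suc m)) * ((-1) ^ i * real (Suc m choose i) * real i ^ m)"
    if "i \<in> {1..Suc m}" for i
  proof -
    have i: "1 \<le> i" "i \<le> Suc m" using that by auto
    have sign: "(-1::real) ^ (Suc m - i) = (-1) ^ Suc m * (-1) ^ i"
      using i by (metis (no_types, lifting) neg_one_power_add_eq_neg_one_power_diff power_add)
    have absorb: "real (Suc (Suc m) choose Suc i) * (real i + 1) = real (Suc (Suc m)) * real (Suc m choose i)"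
      by (metis Suc_times_binomial_eq add.commute mult.commute of_nat_Suc of_nat_mult)
    have ratio: "real i ^ Suc m * (real i / (real i + 1)) powi (int m - int (Suc m)) = real i ^ m * (real i + 1)"
      using i by (simp add: power_int_minus)
    have "(-1) ^ (Suc m - i) * real ((Suc m + 1) choose (i + 1)) * real i ^ Suc m *
        (real i / (real i + 1)) powi (int m - int (Suc m))
      = (-1) ^ (Suc m - i) * real (Suc (Suc m) choose Suc i) * (real i ^ m * (real i + 1))"
      unfolding mult.assoc ratio by simp
    also have "\<dots> = (-1) ^ (Suc m - i) * (real (Suc (Suc m) choose Suc i) * (real i + 1)) * real i ^ m"
      by (simp only: mult_ac)
    finally show ?thesis
      unfolding absorb sign by (simp only: mult_ac)
  qed
  have "(\<Sum>i=1..Suc m. (-1) ^ i * real (Suc m choose i) * real i ^ m)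
      = (\<Sum>i\<le>Suc m. (-1) ^ i * real (Suc m choose i) * real i ^ m)"
    using assms by (intro sum.mono_neutral_left) auto
  also have "\<dots> = 0"
    by (rule alternating_binomial_power_sum) simp
  finally show ?thesis
    unfolding geometric_mixture_def
    by (simp only: sum.cong[OF refl summand] sum_distrib_left[symmetric] mult_zero_right)
qed

section \<open>The array and its uniqueness\<close>

definition explicit_array :: "nat \<Rightarrow> nat \<Rightarrow> real" where
  "explicit_array n k =
     (if k = 0 then of_bool (n = 0) else if n < k then 0 else geometric_mixture n k)"

text \<open>
  In the first column the recursion starts from the entry \<open>p 0 0 = 1\<close>, which is not a value of
  \<open>geometric_mixture\<close>; hence the separate treatment of \<open>k = 1\<close>.
\<close>
lemma birth_array_explicit_array: "birth_array explicit_array"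
proof -
  have "explicit_array (Suc n) (Suc m)
      = real (Suc m) / (real (Suc m) + 1) * explicit_array n (Suc m)
        + 1 / real (Suc m) * explicit_array n m" if "m \<le> n" for n m
  proof (cases "m = 0")
    case True
    have column1: "geometric_mixture (Suc l) 1 = (1 / 2) ^ l" for l
      by (simp add: geometric_mixture_below_diagonal)
    show ?thesis
      using True column1 by (cases n) (simp_all add: explicit_array_def)
  next
    case False
    show ?thesis
    proof (cases "m = n")
      case True
      then show ?thesis
        using False geometric_mixture_recurrence[of n m] geometric_mixture_above_diagonal[of m]
        by (simp add: explicit_array_def)
    next
      case False
      with \<open>m \<noteq> 0\<close> that show ?thesis
        using geometric_mixture_recurrence[of n m] by (simp add: explicit_array_def)
    qed
  qed
  then have "explicit_array (n + 1) k
      = real k / (real k + 1) * explicit_array n k + 1 / real k * explicit_array n (k - 1)"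
    if "1 \<le> k" "k \<le> n + 1" for n k
    using that by (cases k) simp_all
  then show ?thesis
    unfolding birth_array_def by (auto simp: explicit_array_def)
qed

lemma birth_array_unique:
  assumes p: "birth_array p" and q: "birth_array q"
  shows "p = q"
proof -
  have "p n k = q n k" for n k
  proof (induction n arbitrary: k)
    case 0
    then show ?case
      using p q unfolding birth_array_def by (cases k) auto
  next
    case (Suc n)
    consider "k = 0" | "1 \<le> k" "k \<le> n + 1" | "n + 2 \<le> k" by linarith
    then show ?case
    proof cases
      case 1
      then show ?thesis using p q unfolding birth_array_def by auto
    next
      case 2
      then have "p (n + 1) k = q (n + 1) k"
        using p q Suc.IH unfolding birth_array_def by auto
      then show ?thesis by simp
    next
      case 3
      then show ?thesis using p q unfolding birth_array_def by auto
    qed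
  qed
  then show ?thesis by blast
qed

lemma birth_array_closed_form:
  assumes "birth_array p" "1 \<le> k" "k \<le> n"
  shows "p n k = 1 / fact k *
     (\<Sum>i=1..k. (-1) ^ (k - i) * real ((k + 1) choose (i + 1)) * real i ^ k *
        (real i / (real i + 1)) ^ (n - k))"
  using assms birth_array_unique[OF assms(1) birth_array_explicit_array]
    geometric_mixture_below_diagonal[of k n]
  by (simp add: explicit_array_def)

section \<open>One-step equations of the chain\<close>

text \<open>
  The kernel describes conditional probabilities only for states of positive probability; in product
  form the statement extends to all states, as both sides vanish on the others.
\<close>
lemma homogeneous_markov_chain_joint:
  assumes "homogeneous_markov_chain M X K"
  shows "\<P>(\<omega> in M. X (Suc n) \<omega> = j \<and> X n \<omega> = i) = \<P>(\<omega> in M. X n \<omega> = i) * K i j"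
proof -
  interpret prob_space M
    using assms by (simp add: homogeneous_markov_chain_def)
  have [measurable]: "X n \<in> measurable M (count_space UNIV)" for n
    using assms by (simp add: homogeneous_markov_chain_def)
  show ?thesis
  proof (cases "\<P>(\<omega> in M. X n \<omega> = i) > 0")
    case True
    then have "\<P>(\<omega> in M. X (Suc n) \<omega> = j \<bar> X n \<omega> = i) = K i j"
      using assms by (simp add: homogeneous_markov_chain_def)
    then show ?thesis
      using True by (simp add: cond_prob_def field_simps)
  next
    case False
    then have null: "\<P>(\<omega> in M. X n \<omega> = i) = 0"
      by (simp add: zero_less_measure_iff)
    have "\<P>(\<omega> in M. X (Suc n) \<omega> = j \<and> X n \<omega> = i) \<le> \<P>(\<omega> in M. X n \<omega> = i)"
      by (rule finite_measure_mono) (auto, measurable)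
    then show ?thesis
      using null by (simp add: measure_le_0_iff)
  qed
qed

text \<open>
  All moves into \<open>j\<close> from a state outside \<open>S\<close> are null events, and there are only countably many
  such states, so conditioning on the previous state reduces to a finite sum.
\<close>
lemma homogeneous_markov_chain_step:
  assumes chain: "homogeneous_markov_chain M X K"
    and "finite S" and outside: "\<And>i. i \<notin> S \<Longrightarrow> K i j = 0"
  shows "\<P>(\<omega> in M. X (Suc n) \<omega> = j) = (\<Sum>i\<in>S. \<P>(\<omega> in M. X n \<omega> = i) * K i j)"
proof -
  interpret prob_space M
    using chain by (simp add: homogeneous_markov_chain_def)
  have [measurable]: "X n \<in> measurable M (count_space UNIV)" for n
    using chain by (simp add: homogeneous_markov_chain_def)
  have "AE \<omega> in M. \<not> (X (Suc n) \<omega> = j \<and> X n \<omega> = i)" if "i \<notin> S" for i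
  proof -
    have "\<P>(\<omega> in M. X (Suc n) \<omega> = j \<and> X n \<omega> = i) = 0"
      using homogeneous_markov_chain_joint[OF chain] outside[OF that] by simp
    then show ?thesis
      by (subst (asm) prob_Collect_eq_0) auto
  qed
  then have "AE \<omega> in M. \<forall>i. i \<notin> S \<longrightarrow> \<not> (X (Suc n) \<omega> = j \<and> X n \<omega> = i)"
    by (subst AE_all_countable) auto
  then have "\<P>(\<omega> in M. X (Suc n) \<omega> = j)
      = measure M (\<Union>i\<in>S. {\<omega> \<in> space M. X (Suc n) \<omega> = j \<and> X n \<omega> = i})"
    using \<open>finite S\<close> by (intro finite_measure_eq_AE) auto
  also have "\<dots> = (\<Sum>i\<in>S. \<P>(\<omega> in M. X (Suc n) \<omega> = j \<and> X n \<omega> = i))"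
    using \<open>finite S\<close> by (intro finite_measure_finite_Union) (auto simp: disjoint_family_on_def)
  finally show ?thesis
    by (simp add: homogeneous_markov_chain_joint[OF chain])
qed

text \<open>
  State 0 is left at once, as its holding probability is \<open>0 / (1 + 0)\<close>; this gives \<open>p n 0 = 0\<close> for
  \<open>n \<ge> 1\<close>. The zeros above the diagonal follow from the recursion, since a step raises the state by
  at most one.
\<close>
lemma birth_array_of_chain:
  assumes "subordinated_birth_chain M X"
  shows "birth_array (\<lambda>n k. \<P>(\<omega> in M. X n \<omega> = k))"
proof -
  have chain: "homogeneous_markov_chain M X birth_kernel" and start: "AE \<omega> in M. X 0 \<omega> = 0"
    using assms by (simp_all add: subordinated_birth_chain_def)
  interpret prob_space M
    using chain by (simp add: homogeneous_markov_chain_def)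
  have [measurable]: "X n \<in> measurable M (count_space UNIV)" for n
    using chain by (simp add: homogeneous_markov_chain_def)
  define p where "p n k = \<P>(\<omega> in M. X n \<omega> = k)" for n k
  have p00: "p 0 0 = 1"
    unfolding p_def using start by (subst prob_Collect_eq_1) auto
  have p0: "p 0 k = 0" if "k \<noteq> 0" for k
    unfolding p_def using start that by (intro prob_eq_0_AE) auto
  have leave0: "p (Suc n) 0 = 0" for n
    using homogeneous_markov_chain_step[OF chain, of "{}" 0 n]
    by (simp add: p_def birth_kernel_def)
  have step: "p (Suc n) (Suc m)
      = real (Suc m) / (real (Suc m) + 1) * p n (Suc m) + 1 / real (Suc m) * p n m" for n m
    using homogeneous_markov_chain_step[OF chain, of "{m, Suc m}" "Suc m" n]
    by (simp add: p_def birth_kernel_def add_ac)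
  have above: "p n k = 0" if "n < k" for n k
    using that
  proof (induction n arbitrary: k)
    case 0
    then show ?case using p0 by simp
  next
    case (Suc n)
    then show ?case by (cases k) (simp_all add: step)
  qed
  have "p (n + 1) k = real k / (real k + 1) * p n k + 1 / real k * p n (k - 1)" if "1 \<le> k" for n k
    using that step[of n "k - 1"] by simp
  moreover have "p n 0 = 0" if "n \<ge> 1" for n
    using that leave0 by (cases n) auto
  ultimately have "birth_array p"
    unfolding birth_array_def using p00 above by auto
  then show ?thesis by (simp add: p_def [abs_def])
qed

section \<open>State probabilities of the subordinated birth chain\<close>

theorem proposition2p2:
  fixes M :: "'a measure" and X :: "nat \<Rightarrow> 'a \<Rightarrow> nat"
  shows "(\<exists>!p. birth_array p) \<and>
    (\<forall>p. birth_array p \<longrightarrow>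
      (\<forall>n k. 1 \<le> k \<and> k \<le> n \<longrightarrow>
        p n k = 1 / fact k *
          (\<Sum>i=1..k. (-1) ^ (k - i) * real ((k + 1) choose (i + 1)) * real i ^ k *
             (real i / (real i + 1)) ^ (n - k)))) \<and>
    (subordinated_birth_chain M X \<longrightarrow>
      birth_array (\<lambda>n k. \<P>(\<omega> in M. X n \<omega> = k)) \<and>
      (\<forall>n k. 1 \<le> k \<and> k \<le> n \<longrightarrow>
        \<P>(\<omega> in M. X n \<omega> = k) = 1 / fact k *
          (\<Sum>i=1..k. (-1) ^ (k - i) * real ((k + 1) choose (i + 1)) * real i ^ k *
             (real i / (real i + 1)) ^ (n - k))))"
proof (intro conjI impI allI)
  show "\<exists>!p. birth_array p"
    using birth_array_explicit_array birth_array_unique by blast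
next
  fix p :: "nat \<Rightarrow> nat \<Rightarrow> real" and n k :: nat
  assume "birth_array p" "1 \<le> k \<and> k \<le> n"
  then show "p n k = 1 / fact k *
      (\<Sum>i=1..k. (-1) ^ (k - i) * real ((k + 1) choose (i + 1)) * real i ^ k *
         (real i / (real i + 1)) ^ (n - k))"
    using birth_array_closed_form by blast
next
  assume "subordinated_birth_chain M X"
  then show "birth_array (\<lambda>n k. \<P>(\<omega> in M. X n \<omega> = k))"
    by (rule birth_array_of_chain)
next
  fix n k :: nat
  assume "subordinated_birth_chain M X" "1 \<le> k \<and> k \<le> n"
  then show "\<P>(\<omega> in M. X n \<omega> = k) = 1 / fact k *
      (\<Sum>i=1..k. (-1) ^ (k - i) * real ((k + 1) choose (i + 1)) * real i ^ k *
         (real i / (real i + 1)) ^ (n - k))"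
    using birth_array_closed_form[OF birth_array_of_chain] by blast
qed

end
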